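(* Any real cubic equation can be reduced, via changes of variable of the types $x\mapsto\sqrt{|\alpha|}\,x$ and $x\mapsto\pm(x-\alpha)^{\pm1}$ ($\alpha\in\mathbb{R}$), to one of the following four forms: (1) the trivial form $x^3-q=0$, $q\ge0$ (a single real root or a triple root); (2) the positive normal form $x^3+x-q=0$, $q\in\mathbb{R}$ (a single real root); (3) the Tusi form $x^3-x^2+\frac{4}{27}\delta=0$ with $\delta>1$ (a single real root); (4) the Tusi form $x^3-x^2+\frac{4}{27}\delta=0$ with $\delta\in[0,1]$ (three real roots, distinct if $\delta\in(0,1)$). The parenthetical assertions give the real roots of the equations in each form.
   Context: A real cubic equation is $a_3x^3+a_2x^2+a_1x+a_0=0$ with real coefficients and $a_3\neq0$. An equation is reduced to another via changes of variable of given types if the second is obtained from the first by finitely many successive substitutions, each replacing the variable $x$ by an expression of one of the types (with $\alpha\ne0$ in $\sqrt{|\alpha|}\,x$), where after each substitution one may clear denominators and multiply the equation by a nonzero real constant. In (4), roots are counted with multiplicity. *)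

theory Defs
  imports Complex_Main "HOL-Computational_Algebra.Polynomial"
begin

text \<open>
  The equation \<open>p(x) = 0\<close> is represented by the polynomial \<open>p\<close>. One step replaces \<open>x\<close> by one of
  the admissible expressions, clears denominators where there are any, and multiplies the equation
  by a nonzero constant \<open>c\<close>. Here \<open>s = 1\<close> or \<open>s = -1\<close> is the sign in the change of variable.

  In the reciprocal case, \<open>p (s / (x - \<alpha>))\<close> has a pole of order exactly \<open>degree p\<close> at \<open>\<alpha>\<close> (for
  nonzero \<open>p\<close>), so \<open>(x - \<alpha>) ^ degree p\<close> is the least common denominator; no superfluous factors
  are introduced. If \<open>0\<close> is a root of \<open>p\<close>, the degree drops in this step. As no step raises the
  degree, only cubics occur in a reduction of a cubic equation to another cubic equation.
\<close>

inductive reduction_step :: "real poly \<Rightarrow> real poly \<Rightarrow> bool" where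
  scaling:
    "\<alpha> \<noteq> 0 \<Longrightarrow> c \<noteq> 0 \<Longrightarrow>
     (\<forall>x. poly q x = c * poly p (sqrt \<bar>\<alpha>\<bar> * x)) \<Longrightarrow>
     reduction_step p q"
| translation:
    "s \<in> {1, -1} \<Longrightarrow> c \<noteq> 0 \<Longrightarrow>
     (\<forall>x. poly q x = c * poly p (s * (x - \<alpha>))) \<Longrightarrow>
     reduction_step p q"
| reciprocal:
    "s \<in> {1, -1} \<Longrightarrow> c \<noteq> 0 \<Longrightarrow>
     (\<forall>x. x \<noteq> \<alpha> \<longrightarrow> poly q x = c * (x - \<alpha>) ^ degree p * poly p (s / (x - \<alpha>))) \<Longrightarrow>
     reduction_step p q"

definition reducible_to :: "real poly \<Rightarrow> real poly \<Rightarrow> bool" where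
  "reducible_to = reduction_step\<^sup>*\<^sup>*"

definition trivial_form :: "real \<Rightarrow> real poly" where
  "trivial_form q = [:-q, 0, 0, 1:]"

definition positive_normal_form :: "real \<Rightarrow> real poly" where
  "positive_normal_form q = [:-q, 1, 0, 1:]"

definition tusi_form :: "real \<Rightarrow> real poly" where
  "tusi_form \<delta> = [:4 / 27 * \<delta>, 0, -1, 1:]"

text \<open>Roots are counted with multiplicity: the only root of \<open>x\<^sup>3\<close> is triple, not single.\<close>

definition single_real_root :: "real poly \<Rightarrow> bool" where
  "single_real_root p \<longleftrightarrow> (\<exists>r. proots p = {#r#})"

definition triple_real_root :: "real poly \<Rightarrow> bool" where
  "triple_real_root p \<longleftrightarrow> (\<exists>r. proots p = {#r, r, r#})"

end

theory Submission
  imports Defs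
begin

text \<open>
  Depress the cubic to \<open>x\<^sup>3 + b x + c\<close>. If \<open>b \<ge> 0\<close>, a rescaling and possibly a reflection give the
  first two forms. If \<open>b < 0\<close> and \<open>c \<noteq> 0\<close>, the reciprocal substitution kills the linear term, and a
  rescaling normalises the remaining coefficients to a Tusi form with \<open>\<delta> = 27 c\<^sup>2 / (4 \<bar>b\<bar>\<^sup>3)\<close>. In
  the exceptional case \<open>x\<^sup>3 - x\<close> the roots \<open>-1, 0, 1\<close> are first moved to \<open>1, 2, 3\<close>; their reciprocals,
  recentred at their mean, are the roots of a depressed cubic with nonzero constant term. The
  assertions on the roots follow by splitting off one real root and looking at the discriminant of
  the quadratic cofactor.
\<close>

section \<open>Existence of real roots, and splitting off linear factors\<close>

lemma odd_degree_has_real_root: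
  fixes p :: "real poly"
  assumes "odd (degree p)"
  shows "\<exists>x. poly p x = 0"
proof -
  have root_of_pos_lead: "\<exists>x. poly q x = 0" if q: "odd (degree q)" "lead_coeff q > 0" for q :: "real poly"
  proof -
    \<comment> \<open>As the degree is odd, \<open>r\<close>, which is x \<mapsto> -q(-x), has the
      same positive leading coefficient as \<open>q\<close>. Its growth at +infinity therefore makes
      \<open>q\<close> negative far to the left, and the intermediate value theorem applies.\<close>
    define r where "r = - (q \<circ>\<^sub>p [:0, -1:])"
    have "lead_coeff r > 0"
      using q by (simp add: r_def lead_coeff_comp)
    then obtain a where a: "\<forall>x\<ge>a. poly r x \<ge> lead_coeff r"
      using poly_pinfty_gt_lc by blast
    obtain b where b: "\<forall>x\<ge>b. poly q x \<ge> lead_coeff q"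
      using poly_pinfty_gt_lc q by blast
    \<comment> \<open>The 1 ensures that \<open>- m < m\<close>.\<close>
    define m where "m = max 1 (max a b)"
    have "poly r m > 0"
      using a \<open>lead_coeff r > 0\<close> by (smt (verit) m_def max.cobounded1 max.cobounded2)
    then have "poly q (- m) < 0"
      by (simp add: r_def poly_pcompose)
    moreover have "poly q m > 0"
      using b q by (smt (verit) m_def max.cobounded1 max.cobounded2)
    moreover have "- m < m"
      by (simp add: m_def)
    ultimately show ?thesis
      using poly_IVT_pos by blast
  qed
  show ?thesis
  proof (cases "lead_coeff p > 0")
    case True
    with assms root_of_pos_lead show ?thesis by blast
  next
    case False
    moreover have "lead_coeff p \<noteq> 0"
      using assms by (metis degree_0 even_zero leading_coeff_0_iff)
    ultimately have "lead_coeff (- p) > 0"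
      unfolding degree_minus coeff_minus by linarith
    then show ?thesis
      using assms root_of_pos_lead[of "- p"] by simp
  qed
qed

lemma cubic_real_root:
  fixes a b c :: real
  obtains r where "poly [:c, b, a, 1:] r = 0"
  using odd_degree_has_real_root[of "[:c, b, a, 1:]"] by auto

text \<open>Synthetic division by x - r: the remainder is the value at \<open>r\<close>, which
  vanishes.\<close>

lemma cubic_split:
  fixes a b c r :: "'a::comm_ring_1"
  assumes "poly [:c, b, a, 1:] r = 0"
  shows "[:c, b, a, 1:] = [:- r, 1:] * [:b + r * (a + r), a + r, 1:]"
  using assms by (simp add: algebra_simps eq_neg_iff_add_eq_0)

text \<open>Completing the square, 4(x^2 + bx + c) = (2x + b)^2 + (4c - b^2) > 0, so the quadratic
  factor contributes no root.\<close>

lemma single_real_root_linear_mult: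
  assumes "b\<^sup>2 < 4 * c"
  shows "single_real_root ([:- r, 1:] * [:c, b, 1:])"
proof -
  have "poly [:c, b, 1:] x \<noteq> 0" for x
  proof -
    have "(2 * x + b)\<^sup>2 \<ge> 0" by simp
    then have "4 * poly [:c, b, 1:] x > 0"
      using assms by (simp add: algebra_simps power2_eq_square)
    then show ?thesis by auto
  qed
  then have "proots [:c, b, 1:] = {#}"
    by (simp add: multiset_eq_iff order_0I del: poly_pCons)
  then show ?thesis
    unfolding single_real_root_def by (subst proots_mult) auto
qed

lemma quadratic_split:
  fixes b c :: real
  assumes "4 * c \<le> b\<^sup>2"
  obtains u v where "[:c, b, 1:] = [:- u, 1:] * [:- v, 1:]"
proof
  define d where "d = sqrt (b\<^sup>2 - 4 * c)"
  have "d * d = b * b - 4 * c"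
    using assms by (simp add: d_def power2_eq_square)
  then show "[:c, b, 1:] = [:- ((- b + d) / 2), 1:] * [:- ((- b - d) / 2), 1:]"
    by (simp add: field_simps)
qed

lemma proots_three_linear_factors:
  fixes u v w :: real
  shows "proots ([:- u, 1:] * ([:- v, 1:] * [:- w, 1:])) = {#u, v, w#}"
  by (subst proots_mult; simp del: mult_pCons_left mult_pCons_right)+

lemma proots_cube: "proots ([:0, 0, 0, 1:] :: real poly) = {#0, 0, 0#}"
proof -
  have "([:0, 0, 0, 1:] :: real poly) = [:- 0, 1:] * ([:- 0, 1:] * [:- 0, 1:])"
    by simp
  then show ?thesis
    using proots_three_linear_factors[of 0 0 0] by simp
qed

text \<open>The cofactor of a root \<open>r\<close> has discriminant -(3r^2 + 4b). This is negative
  unless b = r = 0, and then c = 0.\<close>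

lemma single_real_root_depressed:
  fixes b c :: real
  assumes "b \<ge> 0" "b \<noteq> 0 \<or> c \<noteq> 0"
  shows "single_real_root [:c, b, 0, 1:]"
proof -
  obtain r where r: "poly [:c, b, 0, 1:] r = 0"
    by (rule cubic_real_root)
  have "b > 0 \<or> r\<^sup>2 > 0"
    using assms r by auto
  then have "r\<^sup>2 < 4 * (b + r\<^sup>2)"
    using assms(1) zero_le_power2[of r] by (smt (verit))
  then have "(0 + r)\<^sup>2 < 4 * (b + r * (0 + r))"
    by (simp add: power2_eq_square)
  then show ?thesis
    by (subst cubic_split[OF r]) (rule single_real_root_linear_mult)
qed

section \<open>Roots of the Tusi form\<close>

lemma tusi_root_eq:
  assumes "poly (tusi_form \<delta>) r = 0"
  shows "r\<^sup>2 * (1 - r) = 4 / 27 * \<delta>"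
  using assms by (simp add: tusi_form_def algebra_simps power2_eq_square)

text \<open>For \<delta> = 1 the form is (x + 1/3)(x - 2/3)^2, since x^3 - x^2 has its local minimum
  -4/27 at 2/3. Hence the sign of 1 - \<delta> tells on which side of -1/3 a root can lie.\<close>

lemma tusi_root_eq_gap:
  assumes "poly (tusi_form \<delta>) r = 0"
  shows "(r + 1 / 3) * (r - 2 / 3)\<^sup>2 = 4 / 27 * (1 - \<delta>)"
proof -
  have "\<delta> = 27 / 4 * (r * r - r * r * r)"
    using assms by (simp add: tusi_form_def field_simps)
  then show ?thesis
    by (simp add: field_simps power2_eq_square)
qed

lemma tusi_cofactor:
  assumes "poly (tusi_form \<delta>) r = 0"
  shows "tusi_form \<delta> = [:- r, 1:] * [:r * (r - 1), r - 1, 1:]"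
  using cubic_split[of "4 / 27 * \<delta>" 0 "-1" r] assms by (simp add: tusi_form_def)

text \<open>The discriminant of the cofactor changes sign exactly at -1/3 and 1. These are the
  bounds on \<open>r\<close> that \<open>tusi_root_eq_gap\<close> and \<open>tusi_root_eq\<close>
  yield.\<close>

lemma tusi_cofactor_discrim: "(r - 1)\<^sup>2 - 4 * (r * (r - 1)) = (1 - r) * (3 * r + (1 :: real))"
  by (simp add: algebra_simps power2_eq_square)

lemma single_real_root_tusi:
  assumes "\<delta> > 1"
  shows "single_real_root (tusi_form \<delta>)"
proof -
  obtain r where r: "poly (tusi_form \<delta>) r = 0"
    unfolding tusi_form_def by (rule cubic_real_root)
  have "(r + 1 / 3) * (r - 2 / 3)\<^sup>2 < 0"
    using tusi_root_eq_gap[OF r] assms by simp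
  then have "r < - 1 / 3"
    by (smt (verit) mult_nonneg_nonneg zero_le_power2 divide_minus_left)
  then have "(1 - r) * (3 * r + 1) < 0"
    by (intro mult_pos_neg) auto
  then have "(r - 1)\<^sup>2 < 4 * (r * (r - 1))"
    using tusi_cofactor_discrim[of r] by simp
  then show ?thesis
    by (subst tusi_cofactor[OF r]) (rule single_real_root_linear_mult)
qed

lemma tusi_splits:
  assumes "0 \<le> \<delta>" "\<delta> \<le> 1"
  obtains u v w where "tusi_form \<delta> = [:- u, 1:] * ([:- v, 1:] * [:- w, 1:])"
proof -
  obtain r where r: "poly (tusi_form \<delta>) r = 0"
    unfolding tusi_form_def by (rule cubic_real_root)
  have "0 \<le> r\<^sup>2 * (1 - r)"
    using tusi_root_eq[OF r] assms by simp
  then have "r \<le> 1"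
    by (auto simp: zero_le_mult_iff)
  have "0 \<le> (r + 1 / 3) * (r - 2 / 3)\<^sup>2"
    using tusi_root_eq_gap[OF r] assms by simp
  then have "0 \<le> 3 * r + 1"
    by (auto simp: zero_le_mult_iff)
  with \<open>r \<le> 1\<close> have "0 \<le> (1 - r) * (3 * r + 1)"
    by simp
  then have "4 * (r * (r - 1)) \<le> (r - 1)\<^sup>2"
    using tusi_cofactor_discrim[of r] by simp
  then obtain v w where "[:r * (r - 1), r - 1, 1:] = [:- v, 1:] * [:- w, 1:]"
    by (rule quadratic_split)
  with tusi_cofactor[OF r] that show thesis by simp
qed

text \<open>A double root is a critical point of x^3 - x^2, hence 0 or 2/3, and these occur for
  \<delta> = 0 and \<delta> = 1. The proof reads this off by comparing coefficients.\<close>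

lemma tusi_double_root:
  fixes u w :: real
  assumes "tusi_form \<delta> = [:- u, 1:] * ([:- u, 1:] * [:- w, 1:])"
  shows "\<delta> = 0 \<or> \<delta> = 1"
proof -
  have eqs: "4 / 27 * \<delta> = - (u * u * w)" "u * (u + 2 * w) = 0" "2 * u + w = 1"
    using assms by (auto simp: tusi_form_def algebra_simps)
  then consider "u = 0" | "u = 2 / 3" "w = - 1 / 3"
    by fastforce
  then show ?thesis
    using eqs(1) by cases auto
qed

lemma card_tusi_roots:
  assumes "0 < \<delta>" "\<delta> < 1"
  shows "card {x. poly (tusi_form \<delta>) x = 0} = 3"
proof -
  obtain u v w where uvw: "tusi_form \<delta> = [:- u, 1:] * ([:- v, 1:] * [:- w, 1:])"
    using tusi_splits assms by (metis less_imp_le)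
  \<comment> \<open>Each pair of roots has to occupy the first two places once, as
    \<open>tusi_double_root\<close> expects.\<close>
  have perm: "tusi_form \<delta> = [:- u, 1:] * ([:- w, 1:] * [:- v, 1:])"
    "tusi_form \<delta> = [:- v, 1:] * ([:- w, 1:] * [:- u, 1:])"
    by (simp_all only: uvw mult_ac)
  have "u \<noteq> v" "u \<noteq> w" "v \<noteq> w"
    using tusi_double_root[of \<delta> u w] tusi_double_root[of \<delta> u v] tusi_double_root[of \<delta> v u]
      uvw perm assms by blast+
  moreover have "{x. poly (tusi_form \<delta>) x = 0} = {u, v, w}"
    unfolding uvw poly_mult by auto
  ultimately show ?thesis by simp
qed

section \<open>Reductions by changes of variable\<close>

lemma reducible_to_trans: "reducible_to p q \<Longrightarrow> reducible_to q r \<Longrightarrow> reducible_to p r"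
  unfolding reducible_to_def by (rule rtranclp_trans)

text \<open>Every positive factor \<open>k\<close> is admissible, being the square root of \<alpha>
  = k^2.\<close>

lemma reducible_to_scaling:
  assumes "k > 0" "c \<noteq> 0" "\<And>x. poly q x = c * poly p (k * x)"
  shows "reducible_to p q"
  unfolding reducible_to_def
  by (rule r_into_rtranclp, rule reduction_step.scaling[of "k\<^sup>2" c]) (use assms in auto)

lemma reducible_to_translation:
  assumes "s \<in> {1, -1}" "c \<noteq> 0" "\<And>x. poly q x = c * poly p (s * (x - \<alpha>))"
  shows "reducible_to p q"
  unfolding reducible_to_def
  by (rule r_into_rtranclp, rule reduction_step.translation[of s c]) (use assms in auto)

lemma reducible_to_reciprocal:
  assumes "s \<in> {1, -1}" "c \<noteq> 0"
    and "\<And>x. x \<noteq> \<alpha> \<Longrightarrow> poly q x = c * (x - \<alpha>) ^ degree p * poly p (s / (x - \<alpha>))"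
  shows "reducible_to p q"
  unfolding reducible_to_def
  by (rule r_into_rtranclp, rule reduction_step.reciprocal[of s c]) (use assms in auto)

lemma reducible_to_depressed:
  assumes "degree p = 3"
  obtains b c where "reducible_to p [:c, b, 0, 1:]"
proof -
  define a\<^sub>0 a\<^sub>1 a\<^sub>2 a\<^sub>3
    where a_defs: "a\<^sub>0 = coeff p 0" "a\<^sub>1 = coeff p 1" "a\<^sub>2 = coeff p 2" "a\<^sub>3 = coeff p 3"
  have p: "poly p x = a\<^sub>0 + a\<^sub>1 * x + a\<^sub>2 * x ^ 2 + a\<^sub>3 * x ^ 3" for x
    using assms by (simp add: poly_altdef a_defs eval_nat_numeral)
  have "a\<^sub>3 \<noteq> 0"
    using assms by (metis a_defs(4) degree_0 leading_coeff_0_iff zero_neq_numeral)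
  show thesis
  proof (rule that, rule reducible_to_translation)
    \<comment> \<open>The shift by a2/(3 a3) moves the mean of the three complex roots to 0, which
      kills the quadratic term.\<close>
    show "poly [:2 * a\<^sub>2 ^ 3 / (27 * a\<^sub>3 ^ 3) - a\<^sub>1 * a\<^sub>2 / (3 * a\<^sub>3\<^sup>2) + a\<^sub>0 / a\<^sub>3,
        a\<^sub>1 / a\<^sub>3 - a\<^sub>2\<^sup>2 / (3 * a\<^sub>3\<^sup>2), 0, 1:] x = 1 / a\<^sub>3 * poly p (1 * (x - a\<^sub>2 / (3 * a\<^sub>3)))" for x
      using \<open>a\<^sub>3 \<noteq> 0\<close> by (simp add: p field_simps power2_eq_square power3_eq_cube)
  qed (use \<open>a\<^sub>3 \<noteq> 0\<close> in auto)
qed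

text \<open>Allows the sign of the constant term to be chosen, for q \<ge> 0 in the trivial form and
  for a positive scaling factor on the way to the Tusi form.\<close>

lemma reducible_to_depressed_reflection: "reducible_to [:c, b, 0, 1:] [:- c, b, 0, 1:]"
  by (rule reducible_to_translation[of "-1" "-1" _ _ 0]) (auto simp: algebra_simps)

lemma reducible_to_trivial_form: "\<exists>q\<ge>0. reducible_to [:c, 0, 0, 1:] (trivial_form q)"
proof (cases "c \<le> 0")
  case True
  then show ?thesis
    by (intro exI[of _ "- c"]) (simp add: trivial_form_def reducible_to_def)
next
  case False
  then show ?thesis
    using reducible_to_depressed_reflection[of c 0] by (intro exI[of _ c]) (simp add: trivial_form_def)
qed

lemma reducible_to_unit_linear_coeff:
  assumes "b \<noteq> 0"
  shows "reducible_to [:c, b, 0, 1:] [:c / sqrt \<bar>b\<bar> ^ 3, sgn b, 0, 1:]"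
proof (rule reducible_to_scaling)
  have "sqrt \<bar>b\<bar> * sqrt \<bar>b\<bar> = \<bar>b\<bar>" "\<bar>b\<bar> * sgn b = b"
    by (auto simp: abs_mult_sgn)
  then show "poly [:c / sqrt \<bar>b\<bar> ^ 3, sgn b, 0, 1:] x = 1 / sqrt \<bar>b\<bar> ^ 3 * poly [:c, b, 0, 1:] (sqrt \<bar>b\<bar> * x)" for x
    using assms by (simp add: field_simps power3_eq_cube)
qed (use assms in auto)

text \<open>Inverting \<open>x\<close> reverses the coefficients, giving c x^3 - b x^2 + 1. Putting
  (b/c) x for \<open>x\<close> makes both leading terms have size b^3/c^2; dividing by this leaves
  the constant c^2/b^3 = 4\<delta>/27.\<close>

lemma reducible_to_tusi_form_pos_const:
  assumes "b > 0" "c > 0"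
  shows "reducible_to [:c, - b, 0, 1:] (tusi_form (27 * c\<^sup>2 / (4 * b ^ 3)))"
proof (rule reducible_to_trans)
  show "reducible_to [:c, - b, 0, 1:] [:1, 0, - b, c:]"
    by (rule reducible_to_reciprocal[of 1 1 0])
      (auto simp: field_simps power3_eq_cube eval_nat_numeral)
  show "reducible_to [:1, 0, - b, c:] (tusi_form (27 * c\<^sup>2 / (4 * b ^ 3)))"
  proof (rule reducible_to_scaling)
    show "poly (tusi_form (27 * c\<^sup>2 / (4 * b ^ 3))) x = c\<^sup>2 / b ^ 3 * poly [:1, 0, - b, c:] (b / c * x)" for x
      using assms by (simp add: tusi_form_def field_simps power2_eq_square power3_eq_cube)
  qed (use assms in auto)
qed

lemma reducible_to_tusi_form:
  assumes "b < 0" "c \<noteq> 0"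
  shows "\<exists>\<delta>\<ge>0. reducible_to [:c, b, 0, 1:] (tusi_form \<delta>)"
proof -
  have "reducible_to [:c, b, 0, 1:] [:\<bar>c\<bar>, b, 0, 1:]"
    using reducible_to_depressed_reflection[of c b] by (cases "c \<ge> 0") (auto simp: reducible_to_def)
  moreover have "reducible_to [:\<bar>c\<bar>, b, 0, 1:] (tusi_form (27 * \<bar>c\<bar>\<^sup>2 / (4 * (- b) ^ 3)))"
    using reducible_to_tusi_form_pos_const[of "- b" "\<bar>c\<bar>"] assms by simp
  moreover have "27 * \<bar>c\<bar>\<^sup>2 / (4 * (- b) ^ 3) \<ge> 0"
    using assms by (intro divide_nonneg_nonneg mult_nonneg_nonneg zero_le_power) auto
  ultimately show ?thesis
    using reducible_to_trans by blast
qed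

text \<open>Inverting x^3 - x directly would lose a degree because of its root 0, hence the detour
  through (x - 1)(x - 2)(x - 3).\<close>

lemma reducible_to_nonzero_const:
  "reducible_to [:0, - 1, 0, 1:] [:- 35 / 2916, - 13 / 108, 0, 1:]"
proof (rule reducible_to_trans)
  show "reducible_to [:0, - 1, 0, 1:] [:- 6, 11, - 6, 1:]"
    by (rule reducible_to_translation[of 1 1 _ _ 2]) (auto simp: algebra_simps)
  show "reducible_to [:- 6, 11, - 6, 1:] [:- 35 / 2916, - 13 / 108, 0, 1:]"
  \<comment> \<open>The mean of 1, 1/2, 1/3 is 11/18, so the new roots are 7/18, -1/9 and -5/18,
    none of them 0. The factor -1/6 makes the reversed polynomial monic.\<close>
  proof (rule reducible_to_reciprocal)
    fix x :: real
    assume "x \<noteq> - 11 / 18"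
    then obtain y where x: "x = y - 11 / 18" and "y \<noteq> 0"
      using that[of "x + 11 / 18"] by (simp add: field_simps)
    show "poly [:- 35 / 2916, - 13 / 108, 0, 1:] x =
        - 1 / 6 * (x - (- 11 / 18)) ^ degree [:- 6, 11, - 6, 1 :: real:] *
        poly [:- 6, 11, - 6, 1:] (1 / (x - (- 11 / 18)))"
      unfolding x using \<open>y \<noteq> 0\<close> by (simp add: field_simps eval_nat_numeral)
  qed auto
qed

lemma reducible_to_tusi_form_neg:
  assumes "b < 0"
  shows "\<exists>\<delta>\<ge>0. reducible_to [:c, b, 0, 1:] (tusi_form \<delta>)"
proof (cases "c = 0")
  case True
  \<comment> \<open>Rescaling brings every \<open>b < 0\<close> to the single equation x^3 - x = 0,
    so one explicit computation suffices.\<close>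
  have "reducible_to [:c, b, 0, 1:] [:0, - 1, 0, 1:]"
    using reducible_to_unit_linear_coeff[of b c] assms True by simp
  moreover obtain \<delta> where "\<delta> \<ge> 0" "reducible_to [:- 35 / 2916, - 13 / 108, 0, 1:] (tusi_form \<delta>)"
    using reducible_to_tusi_form[of "- 13 / 108" "- 35 / 2916"] by auto
  ultimately show ?thesis
    using reducible_to_nonzero_const reducible_to_trans by blast
qed (use reducible_to_tusi_form assms in auto)

theorem theorem4:
  shows "(\<forall>p::real poly. degree p = 3 \<longrightarrow>
            (\<exists>q\<ge>0. reducible_to p (trivial_form q)) \<or>
            (\<exists>q. reducible_to p (positive_normal_form q)) \<or>
            (\<exists>\<delta>>1. reducible_to p (tusi_form \<delta>)) \<or>
            (\<exists>\<delta>\<in>{0..1}. reducible_to p (tusi_form \<delta>))) \<and>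
         (\<forall>q\<ge>0. single_real_root (trivial_form q) \<or> triple_real_root (trivial_form q)) \<and>
         (\<forall>q. single_real_root (positive_normal_form q)) \<and>
         (\<forall>\<delta>>1. single_real_root (tusi_form \<delta>)) \<and>
         (\<forall>\<delta>\<in>{0..1}. size (proots (tusi_form \<delta>)) = 3) \<and>
         (\<forall>\<delta>\<in>{0<..<1}. card {x. poly (tusi_form \<delta>) x = 0} = 3)"
proof (intro conjI allI ballI impI)
  fix p :: "real poly"
  assume "degree p = 3"
  then obtain b c where p: "reducible_to p [:c, b, 0, 1:]"
    by (rule reducible_to_depressed)
  consider "b = 0" | "b > 0" | "b < 0" by linarith
  then show "(\<exists>q\<ge>0. reducible_to p (trivial_form q)) \<or>
            (\<exists>q. reducible_to p (positive_normal_form q)) \<or>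
            (\<exists>\<delta>>1. reducible_to p (tusi_form \<delta>)) \<or>
            (\<exists>\<delta>\<in>{0..1}. reducible_to p (tusi_form \<delta>))"
  proof cases
    case 1
    then show ?thesis
      using p reducible_to_trivial_form reducible_to_trans by blast
  next
    case 2
    then have "reducible_to [:c, b, 0, 1:] (positive_normal_form (- c / sqrt \<bar>b\<bar> ^ 3))"
      using reducible_to_unit_linear_coeff[of b c] by (simp add: positive_normal_form_def)
    then show ?thesis
      using p reducible_to_trans by blast
  next
    case 3
    then obtain \<delta> where "\<delta> \<ge> 0" "reducible_to p (tusi_form \<delta>)"
      using p reducible_to_tusi_form_neg reducible_to_trans by blast
    then show ?thesis
      \<comment> \<open>The value \<delta> = 1 separates the third form from the fourth.\<close>
      by (cases "\<delta> > 1") auto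
  qed
next
  fix q :: real
  assume "q \<ge> 0"
  show "single_real_root (trivial_form q) \<or> triple_real_root (trivial_form q)"
  proof (cases "q = 0")
    case True
    then show ?thesis
      using proots_cube by (auto simp: trivial_form_def triple_real_root_def)
  next
    case False
    then show ?thesis
      using single_real_root_depressed[of 0 "- q"] by (simp add: trivial_form_def)
  qed
next
  fix q :: real
  show "single_real_root (positive_normal_form q)"
    using single_real_root_depressed[of 1 "- q"] by (simp add: positive_normal_form_def)
next
  fix \<delta> :: real
  assume "\<delta> > 1"
  then show "single_real_root (tusi_form \<delta>)"
    by (rule single_real_root_tusi)
next
  fix \<delta> :: real
  assume "\<delta> \<in> {0..1}"
  then obtain u v w where "tusi_form \<delta> = [:- u, 1:] * ([:- v, 1:] * [:- w, 1:])"
    using tusi_splits by (metis atLeastAtMost_iff)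
  then show "size (proots (tusi_form \<delta>)) = 3"
    by (simp only: proots_three_linear_factors) simp
next
  fix \<delta> :: real
  assume "\<delta> \<in> {0<..<1}"
  then show "card {x. poly (tusi_form \<delta>) x = 0} = 3"
    using card_tusi_roots by simp
qed

end
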